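(* Let $X$ be a locally compact Hausdorff space, let $\emptyset \neq H \subset L \subset X$ be arbitrary subsets, and let $k$ be any nonnegative, symmetric kernel on $X$. Then the sets (intervals) $R_n(H,L)$ (for every $n\in\mathbb{N}$, $n\ge 1$), $R(H,L)$ and $A(H,L)$ are nonempty.
   Context: A nonnegative symmetric kernel on $X$ is a function $k:X\times X\to[0,+\infty]$ that is lower semicontinuous on $X\times X$ and satisfies $k(x,y)=k(y,x)$ for all $x,y\in X$. $\mathfrak{M}_1(X)$ is the set of regular Borel probability measures on $X$; each such $\mu$ is identified with its Carathéodory extension to an outer measure. For an arbitrary set $H\subset X$, $\mathfrak{M}_1(H)$ is the set of those $\mu\in\mathfrak{M}_1(X)$ that are concentrated on $H$, i.e. every compact set meets $X\setminus H$ in a set of outer $\mu$-measure zero (equivalently, since $\mu$ is finite, $H$ is $\mu$-measurable in the Carathéodory sense and $\mu(H)=1$). The potential of $\mu$ is $U^\mu(x)=\int_X k(x,y)\,d\mu(y)\in[0,+\infty]$. For $E\subset[0,+\infty]$, $\overline{\mathrm{conv}}\,E$ denotes the closed convex hull of $E$ in $[0,+\infty]$ (compact, with its usual topology), e.g. $\overline{\mathrm{conv}}\,(0,+\infty)=[0,+\infty]$ and $\overline{\mathrm{conv}}\,\{+\infty\}=\{+\infty\}$. For $H,L\subset X$ define $$R_n(H,L)=\bigcap_{w_1,\dots,w_n\in H}\overline{\mathrm{conv}}\Big\{\tfrac1n\sum_{j=1}^n k(x,w_j): x\in L\Big\},\qquad R(H,L)=\bigcap_{n=1}^\infty R_n(H,L),$$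 $$A(H,L)=\bigcap_{\mu\in\mathfrak{M}_1(H)}\overline{\mathrm{conv}}\{U^\mu(x): x\in L\}.$$ The points $w_1,\dots,w_n$ need not be distinct. All these are subsets of $[0,+\infty]$. *)

theory Defs
  imports "HOL-Probability.Probability"
begin

definition lower_semicontinuous :: "('a::topological_space \<Rightarrow> ennreal) \<Rightarrow> bool" where
  "lower_semicontinuous f \<longleftrightarrow> (\<forall>c. open {x. c < f x})"

definition symmetric_kernel :: "('a::topological_space \<Rightarrow> 'a \<Rightarrow> ennreal) \<Rightarrow> bool" where
  "symmetric_kernel k \<longleftrightarrow>
     lower_semicontinuous (\<lambda>(x, y). k x y) \<and> (\<forall>x y. k x y = k y x)"

definition regular_measure :: "'a::topological_space measure \<Rightarrow> bool" where
  "regular_measure \<mu> \<longleftrightarrow> (\<forall>B\<in>sets borel.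
     emeasure \<mu> B = (INF U\<in>{U. open U \<and> B \<subseteq> U}. emeasure \<mu> U) \<and>
     emeasure \<mu> B = (SUP K\<in>{K. compact K \<and> K \<subseteq> B}. emeasure \<mu> K))"

definition regular_prob_measures :: "'a::topological_space measure set" where
  "regular_prob_measures =
     {\<mu>. sets \<mu> = sets borel \<and> prob_space \<mu> \<and> regular_measure \<mu>}"

text \<open>Since \<open>H\<close> need not be Borel, concentration on \<open>H\<close> is expressed by the outer measure.\<close>

definition regular_prob_measures_on :: "'a::topological_space set \<Rightarrow> 'a measure set" where
  "regular_prob_measures_on H =
     {\<mu>\<in>regular_prob_measures. \<forall>K. compact K \<longrightarrow> outer_measure_of \<mu> (K - H) = 0}"

definition potential :: "('a \<Rightarrow> 'a \<Rightarrow> ennreal) \<Rightarrow> 'a measure \<Rightarrow> 'a \<Rightarrow> ennreal" where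
  "potential k \<mu> x = (\<integral>\<^sup>+ y. k x y \<partial>\<mu>)"

text \<open>
  The space \<open>[0, \<infinity>]\<close> is not a real vector space, and convexity of its subsets is meant in the
  order sense. (Closure under combinations \<open>t * x + (1 - t) * y\<close> would be too weak at \<open>\<infinity>\<close>:
  it holds for \<open>{0, \<infinity>}\<close>.)
\<close>

definition order_convex :: "ennreal set \<Rightarrow> bool" where
  "order_convex C \<longleftrightarrow> (\<forall>a\<in>C. \<forall>b\<in>C. {a..b} \<subseteq> C)"

definition closed_conv :: "ennreal set \<Rightarrow> ennreal set" where
  "closed_conv E = (\<lambda>C. closed C \<and> order_convex C) hull E"

lemma closed_conv_eq:
  assumes "E \<noteq> {}"
  shows "closed_conv E = {Inf E..Sup E}"
proof
  show "closed_conv E \<subseteq> {Inf E..Sup E}"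
    unfolding closed_conv_def
    by (rule hull_minimal) (auto simp: order_convex_def Inf_lower Sup_upper intro: order_trans)
next
  have "{Inf E..Sup E} \<subseteq> C" if "E \<subseteq> C" "closed C" "order_convex C" for C
  proof -
    let ?D = "C \<inter> {Inf E..Sup E}"
    have D: "closed ?D" "E \<subseteq> ?D"
      using that by (auto intro: Inf_lower Sup_upper)
    have ne: "?D \<noteq> {}"
      using assms D(2) by blast
    have "Inf ?D \<in> ?D" "Sup ?D \<in> ?D"
      using closed_contains_Inf_cl[OF D(1) ne] closed_contains_Sup_cl[OF D(1) ne] by simp_all
    moreover have "Inf ?D = Inf E"
      using calculation Inf_superset_mono[OF D(2)] by (auto intro: antisym)
    moreover have "Sup ?D = Sup E"
      using calculation Sup_subset_mono[OF D(2)] by (auto intro: antisym)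
    ultimately have "Inf E \<in> C" "Sup E \<in> C"
      by auto
    then show ?thesis
      using that by (simp add: order_convex_def)
  qed
  then show "{Inf E..Sup E} \<subseteq> closed_conv E"
    unfolding closed_conv_def hull_def by blast
qed

definition R_n :: "('a \<Rightarrow> 'a \<Rightarrow> ennreal) \<Rightarrow> nat \<Rightarrow> 'a set \<Rightarrow> 'a set \<Rightarrow> ennreal set" where
  "R_n k n H L =
     (\<Inter>w\<in>{1..n} \<rightarrow> H. closed_conv {(\<Sum>j=1..n. k x (w j)) / of_nat n | x. x \<in> L})"

definition R_inf :: "('a \<Rightarrow> 'a \<Rightarrow> ennreal) \<Rightarrow> 'a set \<Rightarrow> 'a set \<Rightarrow> ennreal set" where
  "R_inf k H L = (\<Inter>n\<in>{1..}. R_n k n H L)"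

definition A_set :: "('a::topological_space \<Rightarrow> 'a \<Rightarrow> ennreal) \<Rightarrow> 'a set \<Rightarrow> 'a set \<Rightarrow> ennreal set" where
  "A_set k H L =
     (\<Inter>\<mu>\<in>regular_prob_measures_on H. closed_conv {potential k \<mu> x | x. x \<in> L})"

end

theory Submission
  imports Defs
begin

text \<open>
  Each closed convex hull is the interval from the infimum to the supremum, so the intersections
  are nonempty once every lower end point is at most every upper one. For the potentials of two
  measures \<open>\<mu>\<close>, \<open>\<nu>\<close> concentrated on \<open>H \<subseteq> L\<close> this holds because the infimum over \<open>L\<close> of the
  potential of \<open>\<mu>\<close> is at most its \<open>\<nu>\<close>-mean, which equals the \<open>\<mu>\<close>-mean of the potential of
  \<open>\<nu>\<close> by symmetry of the kernel; for averages over points, the means are finite double sums.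
  The interchange of integrals for a lower semicontinuous kernel, which need not be
  measurable for the product \<open>\<sigma>\<close>-algebra, rests on inner regularity.
\<close>

section \<open>Semicontinuity and inner regularity\<close>

lemma lower_semicontinuous_borel_measurable:
  assumes "lower_semicontinuous f"
  shows "f \<in> borel_measurable borel"
  using assms unfolding lower_semicontinuous_def
  by (intro borel_measurableI_greater) auto

lemma lower_semicontinuousI:
  assumes "\<And>c x. c < f x \<Longrightarrow> \<exists>U. open U \<and> x \<in> U \<and> (\<forall>z\<in>U. c < f z)"
  shows "lower_semicontinuous f"
  unfolding lower_semicontinuous_def
proof
  fix c
  show "open {x. c < f x}"
    using assms[of c] by (subst open_subopen) fastforce
qed

lemma open_Pair_vimage:
  assumes "open S"
  shows "open (Pair x -` S)"
  using assms by (intro open_vimage continuous_intros) auto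

lemma regular_prob_measuresD:
  assumes "\<mu> \<in> regular_prob_measures"
  shows "prob_space \<mu>" "sets \<mu> = sets borel" "space \<mu> = UNIV" "regular_measure \<mu>"
  using assms sets_eq_imp_space_eq[of \<mu> borel]
  by (auto simp: regular_prob_measures_def)

lemma regular_measure_compact_approx:
  assumes "regular_measure \<mu>" "B \<in> sets borel" "c < emeasure \<mu> B"
  obtains K where "compact K" "K \<subseteq> B" "c < emeasure \<mu> K"
proof -
  have "emeasure \<mu> B = (SUP K\<in>{K. compact K \<and> K \<subseteq> B}. emeasure \<mu> K)"
    using assms(1,2) unfolding regular_measure_def by blast
  then show ?thesis
    using assms(3) that by (auto simp: less_SUP_iff)
qed

text \<open>By inner regularity it is enough to look at compact subsets of \<open>B\<close>; these
  avoid \<open>H\<close>, so concentration makes them null. This is how the condition on a possibly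
  non-Borel \<open>H\<close> yields almost everywhere statements.\<close>

lemma null_of_disjoint_carrier:
  fixes H :: "'a::t2_space set"
  assumes "\<mu> \<in> regular_prob_measures_on H" "B \<in> sets borel" "B \<inter> H = {}"
  shows "emeasure \<mu> B = 0"
proof (rule ccontr)
  have \<mu>: "\<mu> \<in> regular_prob_measures"
    using assms by (auto simp: regular_prob_measures_on_def)
  assume "emeasure \<mu> B \<noteq> 0"
  then have "0 < emeasure \<mu> B"
    by (simp add: zero_less_iff_neq_zero)
  then obtain K where K: "compact K" "K \<subseteq> B" "0 < emeasure \<mu> K"
    using regular_measure_compact_approx[OF regular_prob_measuresD(4)[OF \<mu>] assms(2)] by blast
  have "K - H = K"
    using K assms(3) by blast
  then have "outer_measure_of \<mu> K = 0"
    using assms(1) K(1) by (auto simp: regular_prob_measures_on_def)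
  moreover have "K \<in> sets \<mu>"
    using K(1) regular_prob_measuresD(2)[OF \<mu>] by (simp add: borel_compact)
  ultimately show False
    using K(3) by simp
qed

text \<open>If a compact \<open>K\<close> in the section over \<open>x\<close> has measure above
  \<open>c\<close>, the tube lemma places the same \<open>K\<close> in the sections over all points
  near \<open>x\<close>.\<close>

lemma lower_semicontinuous_emeasure_section:
  fixes S :: "('a::t2_space \<times> 'b::t2_space) set"
  assumes "\<mu> \<in> regular_prob_measures" "open S"
  shows "lower_semicontinuous (\<lambda>x. emeasure \<mu> (Pair x -` S))"
proof (rule lower_semicontinuousI)
  fix c x
  assume "c < emeasure \<mu> (Pair x -` S)"
  then obtain K where K: "compact K" "K \<subseteq> Pair x -` S" "c < emeasure \<mu> K"
    using regular_measure_compact_approx[OF regular_prob_measuresD(4)[OF assms(1)]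
      borel_open[OF open_Pair_vimage[OF assms(2)]]] by blast
  then obtain U where U: "x \<in> U" "open U" "U \<times> K \<subseteq> S"
    using Elementary_Topology.tube_lemma[OF K(1) assms(2), of x] by auto
  have "c < emeasure \<mu> (Pair z -` S)" if "z \<in> U" for z
  proof -
    have "emeasure \<mu> K \<le> emeasure \<mu> (Pair z -` S)"
      using U that open_Pair_vimage[OF assms(2)] regular_prob_measuresD(2)[OF assms(1)]
      by (intro emeasure_mono) auto
    then show ?thesis
      using K(3) by order
  qed
  then show "\<exists>U. open U \<and> x \<in> U \<and> (\<forall>z\<in>U. c < emeasure \<mu> (Pair z -` S))"
    using U by blast
qed

section \<open>Interchange of integrals for open sets\<close>

text \<open>\<open>S\<close> itself need not be measurable. The supremum of the measures of its
  measurable subsets is attained by a union of countably many of them; enlarging \<open>W\<close> by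
  \<open>D\<close> cannot exceed it, and finiteness allows the measure of \<open>W\<close> to be
  cancelled.\<close>

lemma (in finite_measure) ex_essentially_largest_subset:
  "\<exists>W\<in>sets M. W \<subseteq> S \<and> (\<forall>D\<in>sets M. D \<subseteq> S \<longrightarrow> emeasure M (D - W) = 0)"
proof -
  define T where "T = {W \<in> sets M. W \<subseteq> S}"
  have "T \<noteq> {}"
    by (auto simp: T_def)
  then obtain f :: "nat \<Rightarrow> ennreal" where f: "range f \<subseteq> emeasure M ` T"
      "(SUP W\<in>T. emeasure M W) = (SUP n. f n)"
    using ennreal_SUP_countable_SUP[of T "emeasure M"] by auto
  then have "\<forall>n. \<exists>V. V \<in> T \<and> f n = emeasure M V"
    by blast
  then obtain V where V: "\<And>n. V n \<in> T" "\<And>n. f n = emeasure M (V n)"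
    by metis
  define W where "W = (\<Union>n. V n)"
  have W: "W \<in> T"
    using V(1) by (auto simp: W_def T_def)
  have le: "emeasure M D \<le> emeasure M W" if "D \<in> T" for D
  proof -
    have "emeasure M D \<le> (SUP n. f n)"
      using SUP_upper[OF that, of "emeasure M"] f(2) by simp
    also have "\<dots> \<le> emeasure M W"
      using W V by (intro SUP_least) (auto simp: V(2) W_def T_def intro!: emeasure_mono)
    finally show ?thesis .
  qed
  have "emeasure M (D - W) = 0" if "D \<in> T" for D
  proof -
    have "emeasure M W + emeasure M (D - W) = emeasure M (W \<union> D)"
      using that W plus_emeasure[of W M "D - W"] by (auto simp: T_def)
    also have "\<dots> \<le> emeasure M W + 0"
      using le[of "W \<union> D"] that W by (auto simp: T_def)
    finally show ?thesis
      using ennreal_add_left_cancel_le[of "emeasure M W" "emeasure M (D - W)" 0] by simp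
  qed
  then show ?thesis
    using W unfolding T_def by auto
qed

text \<open>
  An open subset of a product space need not be measurable for the product \<open>\<sigma>\<close>-algebra, so
  Tonelli's theorem does not apply to it directly; up to null sections it may be replaced by a
  measurable subset.
\<close>

lemma ex_measurable_kernel_of_open:
  fixes S :: "('a::t2_space \<times> 'b::t2_space) set"
  assumes \<nu>: "\<nu> \<in> regular_prob_measures" and \<mu>: "\<mu> \<in> regular_prob_measures" and S: "open S"
  obtains W where "W \<in> sets (\<nu> \<Otimes>\<^sub>M \<mu>)" "W \<subseteq> S"
    "AE x in \<nu>. emeasure \<mu> (Pair x -` S) = emeasure \<mu> (Pair x -` W)"
proof -
  interpret \<nu>: prob_space \<nu> by (rule regular_prob_measuresD[OF \<nu>])
  interpret \<mu>: prob_space \<mu> by (rule regular_prob_measuresD[OF \<mu>])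
  interpret P: pair_prob_space \<nu> \<mu> ..
  note [simp] = regular_prob_measuresD(2,3)[OF \<nu>] regular_prob_measuresD(2,3)[OF \<mu>]
  obtain W where W: "W \<in> sets (\<nu> \<Otimes>\<^sub>M \<mu>)" "W \<subseteq> S"
      and max: "\<And>D. D \<in> sets (\<nu> \<Otimes>\<^sub>M \<mu>) \<Longrightarrow> D \<subseteq> S \<Longrightarrow> emeasure (\<nu> \<Otimes>\<^sub>M \<mu>) (D - W) = 0"
    using P.ex_essentially_largest_subset[of S] by auto
  let ?f = "\<lambda>x. emeasure \<mu> (Pair x -` S)" and ?g = "\<lambda>x. emeasure \<mu> (Pair x -` W)"
  have f: "?f \<in> borel_measurable \<nu>"
    using lower_semicontinuous_borel_measurable[OF lower_semicontinuous_emeasure_section[OF \<mu> S]]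
    by (simp cong: measurable_cong_sets)
  have g: "?g \<in> borel_measurable \<nu>"
    using W(1) by (rule \<mu>.measurable_emeasure_Pair)
  \<comment> \<open>Sections of \<open>W\<close> lie in those of \<open>S\<close>, so it suffices
    that no rational number separates the two measures on a set of positive measure;
    \<open>N q\<close> is the set where \<open>q\<close> does.\<close>
  define N where "N q = {x. ?g x \<le> q \<and> q < ?f x}" for q
  have N_sets: "N q \<in> sets borel" for q
  proof -
    have "{x \<in> space \<nu>. ?g x \<le> q \<and> q < ?f x} \<in> sets \<nu>"
      using f g by measurable
    then show ?thesis
      by (simp add: N_def)
  qed
  have N_null: "emeasure \<nu> (N q) = 0" for q
  proof (rule ccontr)
    assume "emeasure \<nu> (N q) \<noteq> 0"
    then obtain K where K: "compact K" "K \<subseteq> N q" "0 < emeasure \<nu> K"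
      using regular_measure_compact_approx[OF regular_prob_measuresD(4)[OF \<nu>] N_sets]
      unfolding zero_less_iff_neq_zero[symmetric] by blast
    have Kb: "K \<in> sets borel"
      using K(1) by (simp add: borel_compact)
    \<comment> \<open>Around each point of \<open>K\<close>, inner regularity and the tube lemma
      give a rectangle inside \<open>S\<close> whose second side has measure above
      \<open>q\<close>.\<close>
    have "\<exists>U C. open U \<and> x \<in> U \<and> compact C \<and> q < emeasure \<mu> C \<and> U \<times> C \<subseteq> S" if "x \<in> K" for x
    proof -
      have "q < ?f x"
        using that K(2) by (auto simp: N_def)
      then obtain C where C: "compact C" "C \<subseteq> Pair x -` S" "q < emeasure \<mu> C"
        using regular_measure_compact_approx[OF regular_prob_measuresD(4)[OF \<mu>]
          borel_open[OF open_Pair_vimage[OF S]]] by blast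
      then obtain U where "x \<in> U" "open U" "U \<times> C \<subseteq> S"
        using Elementary_Topology.tube_lemma[OF C(1) S, of x] by auto
      then show ?thesis
        using C by blast
    qed
    then obtain U C where UC: "\<And>x. x \<in> K \<Longrightarrow> open (U x)" "\<And>x. x \<in> K \<Longrightarrow> x \<in> U x"
        "\<And>x. x \<in> K \<Longrightarrow> compact (C x)" "\<And>x. x \<in> K \<Longrightarrow> q < emeasure \<mu> (C x)"
        "\<And>x. x \<in> K \<Longrightarrow> U x \<times> C x \<subseteq> S"
      by metis
    obtain F where F: "F \<subseteq> K" "finite F" "K \<subseteq> (\<Union>x\<in>F. U x)"
      using compactE_image[OF K(1), of K U] UC(1,2) by blast
    have null: "emeasure \<nu> (U x \<inter> K) = 0" if "x \<in> F" for x
    proof -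
      have x: "x \<in> K"
        using that F by blast
      let ?B = "U x \<inter> K" and ?C = "C x"
      have B: "?B \<in> sets \<nu>" and C: "?C \<in> sets \<mu>"
        using UC(1,3)[OF x] Kb by (auto intro: borel_compact)
      \<comment> \<open>This measurable rectangle lies in \<open>S\<close>, so by maximality
        \<open>W\<close> contains almost all of it. Hence over almost every point of
        \<open>?B\<close> the section of \<open>W\<close> has measure above \<open>q\<close>,
        against the definition of \<open>N q\<close>.\<close>
      have D: "?B \<times> ?C \<in> sets (\<nu> \<Otimes>\<^sub>M \<mu>)"
        using B C by auto
      then have "?B \<times> ?C - W \<in> null_sets (\<nu> \<Otimes>\<^sub>M \<mu>)"
        using max[OF D] UC(5)[OF x] W(1) by (auto simp: null_sets_def)
      then have "AE z in \<nu> \<Otimes>\<^sub>M \<mu>. z \<notin> ?B \<times> ?C - W"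
        by (rule AE_not_in)
      then have "AE z in \<nu>. AE y in \<mu>. (z, y) \<notin> ?B \<times> ?C - W"
        by (rule P.AE_pair)
      then have "AE z in \<nu>. z \<notin> ?B"
      proof eventually_elim
        case (elim z)
        show ?case
        proof
          assume z: "z \<in> ?B"
          have "emeasure \<mu> ?C \<le> ?g z"
            using elim z sets_Pair1[OF W(1)] by (intro emeasure_mono_AE) auto
          also have "\<dots> \<le> q"
            using z K(2) by (auto simp: N_def)
          finally show False
            using UC(4)[OF x] by simp
        qed
      qed
      then show ?thesis
        using B by (subst (asm) AE_iff_null_sets[symmetric]) auto
    qed
    have UK: "U x \<inter> K \<in> sets \<nu>" if "x \<in> F" for x
      using that F(1) Kb UC(1) by auto
    then have "emeasure \<nu> K \<le> emeasure \<nu> (\<Union>x\<in>F. U x \<inter> K)"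
      using F by (intro emeasure_mono sets.finite_UN) blast+
    also have "\<dots> \<le> (\<Sum>x\<in>F. emeasure \<nu> (U x \<inter> K))"
      using F(2) UK by (intro emeasure_subadditive_finite) auto
    also have "\<dots> = 0"
      using null by simp
    finally show False
      using K(3) by simp
  qed
  have "AE x in \<nu>. \<forall>q::rat. x \<notin> N (ennreal (real_of_rat q))"
    using N_null N_sets by (subst AE_all_countable) (auto intro!: AE_not_in simp: null_sets_def)
  then have "AE x in \<nu>. ?f x = ?g x"
  proof eventually_elim
    case (elim x)
    have "?g x \<le> ?f x"
      using W(2) open_Pair_vimage[OF S] by (intro emeasure_mono) auto
    moreover have "\<not> ?g x < ?f x"
    proof
      assume "?g x < ?f x"
      then obtain q where "?g x < ennreal (real_of_rat q)" "ennreal (real_of_rat q) < ?f x"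
        using ennreal_rat_dense by blast
      then show False
        using elim by (auto simp: N_def dest: less_imp_le)
    qed
    ultimately show ?case
      by order
  qed
  then show ?thesis
    using that W by blast
qed

text \<open>Tonelli's theorem is applied to the measurable subset \<open>W\<close>. Its sections are
  known to match those of \<open>S\<close> in measure only over almost every \<open>x\<close>; in
  the other variable merely \<open>W \<subseteq> S\<close> is available, hence an
  inequality.\<close>

lemma nn_integral_emeasure_section_le:
  fixes S :: "('a::t2_space \<times> 'b::t2_space) set"
  assumes \<nu>: "\<nu> \<in> regular_prob_measures" and \<mu>: "\<mu> \<in> regular_prob_measures" and S: "open S"
  shows "(\<integral>\<^sup>+x. emeasure \<mu> (Pair x -` S) \<partial>\<nu>) \<le> (\<integral>\<^sup>+y. emeasure \<nu> ((\<lambda>x. (x, y)) -` S) \<partial>\<mu>)"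
proof -
  interpret \<nu>: prob_space \<nu> by (rule regular_prob_measuresD[OF \<nu>])
  interpret \<mu>: prob_space \<mu> by (rule regular_prob_measuresD[OF \<mu>])
  interpret P: pair_prob_space \<nu> \<mu> ..
  obtain W where W: "W \<in> sets (\<nu> \<Otimes>\<^sub>M \<mu>)" "W \<subseteq> S"
    "AE x in \<nu>. emeasure \<mu> (Pair x -` S) = emeasure \<mu> (Pair x -` W)"
    using ex_measurable_kernel_of_open[OF assms] by blast
  have "(\<integral>\<^sup>+x. emeasure \<mu> (Pair x -` S) \<partial>\<nu>) = (\<integral>\<^sup>+x. emeasure \<mu> (Pair x -` W) \<partial>\<nu>)"
    using W(3) by (rule nn_integral_cong_AE)
  also have "\<dots> = (\<integral>\<^sup>+y. emeasure \<nu> ((\<lambda>x. (x, y)) -` W) \<partial>\<mu>)"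
    using P.emeasure_pair_measure_alt2[OF W(1)] \<mu>.emeasure_pair_measure_alt[OF W(1)] by simp
  also have "\<dots> \<le> (\<integral>\<^sup>+y. emeasure \<nu> ((\<lambda>x. (x, y)) -` S) \<partial>\<mu>)"
  proof (intro nn_integral_mono emeasure_mono)
    show "(\<lambda>x. (x, y)) -` S \<in> sets \<nu>" for y
      using S regular_prob_measuresD(2)[OF \<nu>]
      by (auto intro!: borel_open open_vimage continuous_intros)
  qed (use W(2) in auto)
  finally show ?thesis .
qed

section \<open>Approximation of kernels by open layers\<close>

text \<open>
  The sum of \<open>e\<close> over all \<open>i \<ge> 1\<close> with \<open>i * e < a\<close> lies between \<open>a - e\<close> and \<open>a\<close>. The
  half-lines are open, so composing with a lower semicontinuous kernel gives a combination of
  indicators of open sets.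
\<close>

definition layers :: "ennreal \<Rightarrow> ennreal \<Rightarrow> ennreal" where
  "layers e a = (\<Sum>i. e * indicator {of_nat (Suc i) * e<..} a)"

lemma layers_le: "layers e a \<le> a"
proof -
  define s where "s n = (\<Sum>i<n. e * indicator {of_nat (Suc i) * e<..} a)" for n
  have s_Suc: "s (Suc n) = (if of_nat (Suc n) * e < a then s n + e else s n)" for n
    by (simp add: s_def indicator_def del: of_nat_Suc)
  have mult_Suc: "of_nat (Suc n) * e = of_nat n * e + e" for n
    by (simp add: algebra_simps)
  \<comment> \<open>The bound by \<open>of_nat n * e\<close> strengthens the induction: a further
    \<open>e\<close> is added only if \<open>of_nat (Suc n) * e < a\<close>, and then the new sum
    still stays below \<open>a\<close>.\<close>
  have "s n \<le> min a (of_nat n * e)" for n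
  proof (induction n)
    case 0
    show ?case
      by (simp add: s_def)
  next
    case (Suc n)
    then have le: "s n \<le> a" "s n \<le> of_nat n * e"
      by simp_all
    have "s n + e \<le> of_nat (Suc n) * e"
      unfolding mult_Suc using le(2) by (rule add_right_mono)
    moreover have "s n \<le> of_nat (Suc n) * e"
      unfolding mult_Suc using le(2) by (rule add_increasing2[rotated]) simp
    ultimately show ?case
      unfolding s_Suc using le(1) by (auto simp del: of_nat_Suc)
  qed
  then have "s n \<le> a" for n
    by simp
  then show ?thesis
    unfolding layers_def by (intro suminf_le_const) (simp_all add: s_def)
qed

lemma le_layers_add:
  assumes "0 < e"
  shows "a \<le> layers e a + e"
proof -
  define s where "s n = (\<Sum>i<n. e * indicator {of_nat (Suc i) * e<..} a)" for n
  have s_Suc: "s (Suc n) = (if of_nat (Suc n) * e < a then s n + e else s n)" for n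
    by (simp add: s_def indicator_def del: of_nat_Suc)
  have mult_Suc: "of_nat (Suc n) * e = of_nat n * e + e" for n
    by (simp add: algebra_simps)
  \<comment> \<open>The partial sums follow the multiples of \<open>e\<close> with a lag of at most
    \<open>e\<close>; once the multiples reach \<open>a\<close>, no term is added and
    \<open>a \<le> s n + e\<close> persists.\<close>
  have *: "min a (of_nat (Suc n) * e) \<le> s n + e" for n
  proof (induction n)
    case 0
    show ?case
      by (simp add: s_def)
  next
    case (Suc n)
    show ?case
    proof (cases "of_nat (Suc n) * e < a")
      case True
      then have "of_nat (Suc n) * e \<le> s n + e"
        using Suc by (simp add: min_def split: if_splits del: of_nat_Suc)
      then have "of_nat (Suc n) * e + e \<le> s n + e + e"
        by (rule add_right_mono)
      then show ?thesis
        unfolding s_Suc mult_Suc[of "Suc n"] using True by (simp add: min.coboundedI2 del: of_nat_Suc)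
    next
      case False
      then have "a \<le> s n + e"
        using Suc by (simp add: min_def split: if_splits del: of_nat_Suc)
      then show ?thesis
        unfolding s_Suc using False by (simp add: min.coboundedI1 del: of_nat_Suc)
    qed
  qed
  have "s n \<le> layers e a" for n
    unfolding layers_def s_def by (intro sum_le_suminf) auto
  then have le: "min a (of_nat (Suc n) * e) \<le> layers e a + e" for n
    by (rule order_trans[OF * add_right_mono])
  show ?thesis
  proof (rule ccontr)
    assume "\<not> ?thesis"
    then have lt: "layers e a + e < a"
      by simp
    \<comment> \<open>The smaller term of the minimum can no longer be \<open>a\<close>, so all
      multiples of \<open>e\<close> are bounded by a value below \<open>top\<close>. This is absurd
      for \<open>0 < e\<close>, and the argument covers infinite \<open>a\<close>.\<close>
    then have "of_nat (Suc n) * e \<le> layers e a + e" for n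
      using le[of n] by (simp add: min_def split: if_splits del: of_nat_Suc)
    moreover have "of_nat n * e \<le> of_nat (Suc n) * e" for n
      unfolding mult_Suc by simp
    ultimately have "(SUP n. of_nat n * e) \<le> layers e a + e"
      by (intro SUP_least) (rule order_trans)
    moreover have "(SUP n. of_nat n * e) = (SUP n. of_nat n) * e"
      by (simp add: SUP_mult_right_ennreal)
    then have "(SUP n. of_nat n * e) = top"
      using assms by (simp add: ennreal_SUP_of_nat_eq_top ennreal_top_mult)
    ultimately have "top \<le> layers e a + e"
      by simp
    then show False
      using lt by (metis leD top_greatest order_less_le_trans)
  qed
qed

text \<open>This reduces integrals to measures of superlevel sets, which are open for a lower
  semicontinuous kernel.\<close>

lemma nn_integral_layers:
  assumes "f \<in> borel_measurable M"
  shows "(\<integral>\<^sup>+x. layers e (f x) \<partial>M) =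
    (\<Sum>i. e * emeasure M {x\<in>space M. of_nat (Suc i) * e < f x})"
proof -
  have "(\<integral>\<^sup>+x. layers e (f x) \<partial>M) =
      (\<integral>\<^sup>+x. (\<Sum>i. e * indicator {x\<in>space M. of_nat (Suc i) * e < f x} x) \<partial>M)"
    unfolding layers_def by (intro nn_integral_cong suminf_cong) (auto simp: indicator_def)
  also have "\<dots> = (\<Sum>i. e * emeasure M {x\<in>space M. of_nat (Suc i) * e < f x})"
    using assms by (subst nn_integral_suminf) (auto simp: nn_integral_cmult_indicator)
  finally show ?thesis .
qed

lemma lower_semicontinuous_section:
  assumes "lower_semicontinuous (\<lambda>(x, y). k x y)"
  shows "lower_semicontinuous (k x)"
  unfolding lower_semicontinuous_def
proof
  fix c
  have "open (Pair x -` {p. c < (case p of (x, y) \<Rightarrow> k x y)})"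
    using assms unfolding lower_semicontinuous_def by (intro open_Pair_vimage) auto
  then show "open {y. c < k x y}"
    by (simp add: vimage_def)
qed

lemma nn_integral_layers_kernel:
  assumes "lower_semicontinuous (\<lambda>(x, y). k x y)" "\<mu> \<in> regular_prob_measures"
  shows "(\<integral>\<^sup>+y. layers e (k x y) \<partial>\<mu>) =
    (\<Sum>i. e * emeasure \<mu> (Pair x -` {(x, y). of_nat (Suc i) * e < k x y}))"
proof -
  have "k x \<in> borel_measurable \<mu>"
    using lower_semicontinuous_borel_measurable[OF lower_semicontinuous_section[OF assms(1)]]
      regular_prob_measuresD(2)[OF assms(2)] by (simp cong: measurable_cong_sets)
  then show ?thesis
    by (subst nn_integral_layers) (simp_all add: regular_prob_measuresD(3)[OF assms(2)] vimage_def)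
qed

text \<open>The function is a countable sum of multiples of measures of sections of open sets, each
  lower semicontinuous in \<open>x\<close>.\<close>

lemma measurable_layers_kernel:
  fixes k :: "'a::t2_space \<Rightarrow> 'b::t2_space \<Rightarrow> ennreal"
  assumes "lower_semicontinuous (\<lambda>(x, y). k x y)" "\<mu> \<in> regular_prob_measures"
  shows "(\<lambda>x. \<integral>\<^sup>+y. layers e (k x y) \<partial>\<mu>) \<in> borel_measurable borel"
proof -
  have "open {(x, y). of_nat (Suc i) * e < k x y}" for i
    using assms(1) unfolding lower_semicontinuous_def by (auto simp: case_prod_unfold)
  from lower_semicontinuous_borel_measurable[OF lower_semicontinuous_emeasure_section[OF assms(2) this]]
  show ?thesis
    unfolding nn_integral_layers_kernel[OF assms] by measurable
qed

text \<open>Total mass one keeps the pointwise error \<open>e\<close> of \<open>layers\<close> from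
  growing under integration.\<close>

lemma (in prob_space) nn_integral_layers_bounds:
  assumes "f \<in> borel_measurable M" "0 < e"
  shows "(\<integral>\<^sup>+x. layers e (f x) \<partial>M) \<le> (\<integral>\<^sup>+x. f x \<partial>M)"
    and "(\<integral>\<^sup>+x. f x \<partial>M) \<le> (\<integral>\<^sup>+x. layers e (f x) \<partial>M) + e"
proof -
  have meas: "(\<lambda>x. layers e (f x)) \<in> borel_measurable M"
    using assms(1) unfolding layers_def by measurable
  show "(\<integral>\<^sup>+x. layers e (f x) \<partial>M) \<le> (\<integral>\<^sup>+x. f x \<partial>M)"
    by (intro nn_integral_mono layers_le)
  have "(\<integral>\<^sup>+x. f x \<partial>M) \<le> (\<integral>\<^sup>+x. layers e (f x) + e \<partial>M)"
    using assms(2) by (intro nn_integral_mono le_layers_add)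
  also have "\<dots> = (\<integral>\<^sup>+x. layers e (f x) \<partial>M) + e"
    using meas by (simp add: nn_integral_add emeasure_space_1)
  finally show "(\<integral>\<^sup>+x. f x \<partial>M) \<le> (\<integral>\<^sup>+x. layers e (f x) \<partial>M) + e" .
qed

section \<open>Potentials and mutual energy\<close>

text \<open>The layered integrals of width \<open>1 / real (Suc n)\<close> stay below the potential
  and miss it by at most that width, so the potential is their countable supremum.\<close>

lemma measurable_potential:
  fixes k :: "'a::t2_space \<Rightarrow> 'a \<Rightarrow> ennreal"
  assumes k: "lower_semicontinuous (\<lambda>(x, y). k x y)" and \<mu>: "\<mu> \<in> regular_prob_measures"
  shows "potential k \<mu> \<in> borel_measurable borel"
proof -
  interpret prob_space \<mu> by (rule regular_prob_measuresD[OF \<mu>])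
  let ?e = "\<lambda>n. ennreal (1 / real (Suc n))"
  let ?L = "\<lambda>n x. \<integral>\<^sup>+y. layers (?e n) (k x y) \<partial>\<mu>"
  have kx: "k x \<in> borel_measurable \<mu>" for x
    using lower_semicontinuous_borel_measurable[OF lower_semicontinuous_section[OF k]]
      regular_prob_measuresD(2)[OF \<mu>] by (simp cong: measurable_cong_sets)
  have "potential k \<mu> x = (SUP n. ?L n x)" for x
  proof (rule antisym)
    show "potential k \<mu> x \<le> (SUP n. ?L n x)"
    proof (rule ennreal_le_epsilon)
      fix e :: real assume "0 < e"
      then obtain n where n: "1 / real (Suc n) < e"
        using reals_Archimedean by (metis inverse_eq_divide)
      have "potential k \<mu> x \<le> ?L n x + ?e n"
        unfolding potential_def using kx by (rule nn_integral_layers_bounds) simp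
      also have "\<dots> \<le> (SUP n. ?L n x) + ennreal e"
        using n by (intro add_mono SUP_upper ennreal_leI) auto
      finally show "potential k \<mu> x \<le> (SUP n. ?L n x) + ennreal e" .
    qed
    show "(SUP n. ?L n x) \<le> potential k \<mu> x"
      unfolding potential_def using kx by (intro SUP_least nn_integral_layers_bounds) auto
  qed
  then have "potential k \<mu> = (\<lambda>x. SUP n. ?L n x)"
    by auto
  then show ?thesis
    using measurable_layers_kernel[OF k \<mu>] by simp
qed

text \<open>Both sides are compared with layered integrals, where the interchange concerns only the
  open sets \<open>S i\<close>. The layering error is at most an arbitrary \<open>r > 0\<close>.
  Exchanging \<mu> and \<nu> gives the reverse inequality.\<close>

lemma nn_integral_potential_le:
  fixes k :: "'a::t2_space \<Rightarrow> 'a \<Rightarrow> ennreal"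
  assumes k: "symmetric_kernel k"
    and \<nu>: "\<nu> \<in> regular_prob_measures" and \<mu>: "\<mu> \<in> regular_prob_measures"
  shows "(\<integral>\<^sup>+x. potential k \<mu> x \<partial>\<nu>) \<le> (\<integral>\<^sup>+y. potential k \<nu> y \<partial>\<mu>)"
proof (rule ennreal_le_epsilon)
  fix r :: real
  assume "0 < r"
  define e where "e = ennreal r"
  have e: "0 < e"
    using \<open>0 < r\<close> by (simp add: e_def)
  interpret \<nu>: prob_space \<nu> by (rule regular_prob_measuresD[OF \<nu>])
  interpret \<mu>: prob_space \<mu> by (rule regular_prob_measuresD[OF \<mu>])
  have lsc: "lower_semicontinuous (\<lambda>(x, y). k x y)" and sym: "k x y = k y x" for x y
    using k by (auto simp: symmetric_kernel_def)
  have kx: "k x \<in> borel_measurable \<mu>" "k x \<in> borel_measurable \<nu>" for x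
    using lower_semicontinuous_borel_measurable[OF lower_semicontinuous_section[OF lsc]]
      regular_prob_measuresD(2)[OF \<mu>] regular_prob_measuresD(2)[OF \<nu>]
    by (simp_all cong: measurable_cong_sets)
  define S where "S i = {(x, y). of_nat (Suc i) * e < k x y}" for i
  have S: "open (S i)" for i
    using lsc unfolding lower_semicontinuous_def by (auto simp: S_def case_prod_unfold)
  \<comment> \<open>Here the symmetry of \<open>k\<close> enters: sections in the two variables
    coincide.\<close>
  have S_swap: "(\<lambda>x. (x, y)) -` S i = Pair y -` S i" for i y
    by (auto simp: S_def sym)
  have S_meas: "(\<lambda>x. emeasure \<rho> (Pair x -` S i)) \<in> borel_measurable \<sigma>"
    if "\<rho> \<in> regular_prob_measures" "\<sigma> \<in> regular_prob_measures" for \<rho> \<sigma> i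
    using lower_semicontinuous_borel_measurable[OF lower_semicontinuous_emeasure_section[OF that(1) S]]
      regular_prob_measuresD(2)[OF that(2)] by (simp cong: measurable_cong_sets)
  have L: "(\<integral>\<^sup>+x. (\<integral>\<^sup>+y. layers e (k x y) \<partial>\<rho>) \<partial>\<sigma>) =
      (\<Sum>i. e * (\<integral>\<^sup>+x. emeasure \<rho> (Pair x -` S i) \<partial>\<sigma>))"
    if "\<rho> \<in> regular_prob_measures" "\<sigma> \<in> regular_prob_measures" for \<rho> \<sigma>
    unfolding nn_integral_layers_kernel[OF lsc that(1)] S_def[symmetric]
    using S_meas[OF that] by (subst nn_integral_suminf) (auto simp: nn_integral_cmult)
  have "(\<lambda>x. \<integral>\<^sup>+y. layers e (k x y) \<partial>\<mu>) \<in> borel_measurable \<nu>"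
    using measurable_layers_kernel[OF lsc \<mu>] regular_prob_measuresD(2)[OF \<nu>]
    by (simp cong: measurable_cong_sets)
  moreover have "(\<integral>\<^sup>+x. potential k \<mu> x \<partial>\<nu>) \<le> (\<integral>\<^sup>+x. (\<integral>\<^sup>+y. layers e (k x y) \<partial>\<mu>) + e \<partial>\<nu>)"
    unfolding potential_def using kx(1) e by (intro nn_integral_mono \<mu>.nn_integral_layers_bounds)
  ultimately have "(\<integral>\<^sup>+x. potential k \<mu> x \<partial>\<nu>) \<le> (\<integral>\<^sup>+x. (\<integral>\<^sup>+y. layers e (k x y) \<partial>\<mu>) \<partial>\<nu>) + e"
    by (simp add: nn_integral_add \<nu>.emeasure_space_1)
  also have "(\<integral>\<^sup>+x. (\<integral>\<^sup>+y. layers e (k x y) \<partial>\<mu>) \<partial>\<nu>) \<le> (\<integral>\<^sup>+y. (\<integral>\<^sup>+x. layers e (k y x) \<partial>\<nu>) \<partial>\<mu>)"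
    unfolding L[OF \<mu> \<nu>] L[OF \<nu> \<mu>]
    using nn_integral_emeasure_section_le[OF \<nu> \<mu> S]
    by (intro suminf_le mult_left_mono) (auto simp: S_swap)
  also have "\<dots> \<le> (\<integral>\<^sup>+y. potential k \<nu> y \<partial>\<mu>)"
    unfolding potential_def by (intro nn_integral_mono layers_le)
  finally show "(\<integral>\<^sup>+x. potential k \<mu> x \<partial>\<nu>) \<le> (\<integral>\<^sup>+y. potential k \<nu> y \<partial>\<mu>) + ennreal r"
    by (simp add: e_def add_right_mono)
qed

lemma INF_potential_le_SUP_potential:
  fixes k :: "'a::t2_space \<Rightarrow> 'a \<Rightarrow> ennreal"
  assumes k: "symmetric_kernel k" and "H \<subseteq> L"
    and \<mu>: "\<mu> \<in> regular_prob_measures_on H" and \<nu>: "\<nu> \<in> regular_prob_measures_on H"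
  shows "(INF x\<in>L. potential k \<mu> x) \<le> (SUP x\<in>L. potential k \<nu> x)"
proof -
  have reg: "\<mu> \<in> regular_prob_measures" "\<nu> \<in> regular_prob_measures"
    using \<mu> \<nu> by (auto simp: regular_prob_measures_on_def)
  note [simp] = regular_prob_measuresD(2,3)[OF reg(1)] regular_prob_measuresD(2,3)[OF reg(2)]
  interpret \<nu>: prob_space \<nu> by (rule regular_prob_measuresD[OF reg(2)])
  interpret \<mu>: prob_space \<mu> by (rule regular_prob_measuresD[OF reg(1)])
  have lsc: "lower_semicontinuous (\<lambda>(x, y). k x y)"
    using k by (simp add: symmetric_kernel_def)
  note [measurable] = measurable_potential[OF lsc reg(1)] measurable_potential[OF lsc reg(2)]
  let ?a = "INF x\<in>L. potential k \<mu> x" and ?b = "SUP x\<in>L. potential k \<nu> x"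
  \<comment> \<open>Points where the potential falls below its infimum over \<open>L\<close> lie
    outside \<open>L\<close>, hence outside \<open>H\<close>, and form a Borel set; so they are
    \<open>\<nu>\<close>-null and the bound may be integrated.\<close>
  have "{x \<in> space borel. potential k \<mu> x < ?a} \<in> sets borel"
    by measurable
  moreover have "{x. potential k \<mu> x < ?a} \<inter> H = {}"
    using \<open>H \<subseteq> L\<close> leD[OF INF_lower[of _ L "potential k \<mu>"]] by blast
  ultimately have "{x. potential k \<mu> x < ?a} \<in> null_sets \<nu>"
    using null_of_disjoint_carrier[OF \<nu>] by (simp add: null_sets_def)
  then have "AE x in \<nu>. ?a \<le> potential k \<mu> x"
    by (rule AE_I') auto
  then have "(\<integral>\<^sup>+x. ?a \<partial>\<nu>) \<le> (\<integral>\<^sup>+x. potential k \<mu> x \<partial>\<nu>)"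
    by (rule nn_integral_mono_AE)
  then have "?a \<le> (\<integral>\<^sup>+x. potential k \<mu> x \<partial>\<nu>)"
    using \<nu>.emeasure_space_1 by simp
  also have "\<dots> \<le> (\<integral>\<^sup>+x. potential k \<nu> x \<partial>\<mu>)"
    using k reg(2,1) by (rule nn_integral_potential_le)
  also have "\<dots> \<le> ?b"
  proof -
    have "{x \<in> space borel. ?b < potential k \<nu> x} \<in> sets borel"
      by measurable
    moreover have "{x. ?b < potential k \<nu> x} \<inter> H = {}"
      using \<open>H \<subseteq> L\<close> leD[OF SUP_upper[of _ L "potential k \<nu>"]] by blast
    ultimately have "{x. ?b < potential k \<nu> x} \<in> null_sets \<mu>"
      using null_of_disjoint_carrier[OF \<mu>] by (simp add: null_sets_def)
    then have "AE x in \<mu>. potential k \<nu> x \<le> ?b"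
      by (rule AE_I') auto
    then have "(\<integral>\<^sup>+x. potential k \<nu> x \<partial>\<mu>) \<le> (\<integral>\<^sup>+x. ?b \<partial>\<mu>)"
      by (rule nn_integral_mono_AE)
    then show ?thesis
      using \<mu>.emeasure_space_1 by simp
  qed
  finally show ?thesis .
qed

section \<open>Averages over finitely many points\<close>

lemma sum_const_divide_ennreal:
  fixes c :: ennreal
  assumes "1 \<le> n"
  shows "(\<Sum>j=1..n. c) / of_nat n = c"
proof -
  have "(\<Sum>j=1..n. c) = c * of_nat n"
    by (simp add: mult.commute)
  then show ?thesis
    using assms by (simp only:) (subst ennreal_mult_divide_eq, auto)
qed

text \<open>Both sides are compared with the double average of \<open>k (v j) (w i)\<close>. The
  sizes \<open>m\<close> and \<open>n\<close> are independent because \<open>R_inf\<close>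
  intersects over all sizes at once.\<close>

lemma INF_average_le_SUP_average:
  fixes k :: "'a \<Rightarrow> 'a \<Rightarrow> ennreal"
  assumes sym: "\<And>x y. k x y = k y x" and "1 \<le> m" "1 \<le> n"
    and v: "v \<in> {1..m} \<rightarrow> L" and w: "w \<in> {1..n} \<rightarrow> L"
  shows "(INF x\<in>L. (\<Sum>j=1..m. k x (v j)) / of_nat m) \<le>
    (SUP x\<in>L. (\<Sum>j=1..n. k x (w j)) / of_nat n)" (is "?a \<le> ?b")
proof -
  have "?a = (\<Sum>i=1..n. ?a) / of_nat n"
    using sum_const_divide_ennreal[OF \<open>1 \<le> n\<close>] by simp
  also have "\<dots> \<le> (\<Sum>i=1..n. (\<Sum>j=1..m. k (w i) (v j)) / of_nat m) / of_nat n"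
    using w by (intro divide_right_mono_ennreal sum_mono INF_lower) auto
  also have "\<dots> = (\<Sum>i=1..n. \<Sum>j=1..m. k (v j) (w i) * inverse (of_nat m) * inverse (of_nat n))"
    by (simp add: divide_ennreal_def sum_distrib_right sym[of "w _"])
  also have "\<dots> = (\<Sum>j=1..m. \<Sum>i=1..n. k (v j) (w i) * inverse (of_nat n) * inverse (of_nat m))"
    by (subst sum.swap) (simp add: mult_ac)
  also have "\<dots> = (\<Sum>j=1..m. (\<Sum>i=1..n. k (v j) (w i)) / of_nat n) / of_nat m"
    by (simp add: divide_ennreal_def sum_distrib_right)
  also have "\<dots> \<le> (\<Sum>j=1..m. ?b) / of_nat m"
    using v by (intro divide_right_mono_ennreal sum_mono SUP_upper) auto
  also have "\<dots> = ?b"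
    using sum_const_divide_ennreal[OF \<open>1 \<le> m\<close>] by simp
  finally show ?thesis .
qed

section \<open>Common points of families of intervals\<close>

text \<open>Helly's theorem on a line: the supremum of all lower end points lies in every interval.
  As \<open>ennreal\<close> is a complete lattice, the family may be arbitrary; for an empty one the
  intersection is the whole of \<open>ennreal\<close>.\<close>

lemma INT_closed_conv_nonempty:
  fixes f :: "'i \<Rightarrow> 'a \<Rightarrow> ennreal"
  assumes "L \<noteq> {}"
    and le: "\<And>i j. i \<in> I \<Longrightarrow> j \<in> I \<Longrightarrow> (INF x\<in>L. f i x) \<le> (SUP x\<in>L. f j x)"
  shows "(\<Inter>i\<in>I. closed_conv {f i x | x. x \<in> L}) \<noteq> {}"
proof -
  have eq: "closed_conv {f i x | x. x \<in> L} = {(INF x\<in>L. f i x)..(SUP x\<in>L. f i x)}" for i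
    using assms(1) by (subst closed_conv_eq) (auto simp: image_def Setcompr_eq_image)
  have "(SUP i\<in>I. INF x\<in>L. f i x) \<in> closed_conv {f j x | x. x \<in> L}" if "j \<in> I" for j
    unfolding eq using that le by (auto intro: SUP_upper SUP_least)
  then show ?thesis
    by blast
qed

theorem theorem6p3:
  fixes k :: "'a::t2_space \<Rightarrow> 'a \<Rightarrow> ennreal" and H L :: "'a set"
  assumes "locally_compact_space (euclidean :: 'a topology)"
    and "symmetric_kernel k"
    and "H \<noteq> {}" and "H \<subseteq> L"
  shows "(\<forall>n\<ge>1. R_n k n H L \<noteq> {}) \<and> R_inf k H L \<noteq> {} \<and> A_set k H L \<noteq> {}"
proof -
  have "L \<noteq> {}"
    using assms by blast
  have sym: "k x y = k y x" for x y
    using assms(2) by (simp add: symmetric_kernel_def)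
  \<comment> \<open>Pairs of a size and a tuple turn the nested intersection in \<open>R_inf\<close>
    into a single one, so one point serves all \<open>n\<close> together; the claim for each
    \<open>R_n\<close> then follows by inclusion.\<close>
  define I where "I = (SIGMA n:{1..}. {1..n::nat} \<rightarrow> H)"
  define f where "f = (\<lambda>(n, w) x. (\<Sum>j=1..n. k x (w j)) / of_nat n)"
  have "(\<Inter>i\<in>I. closed_conv {f i x | x. x \<in> L}) \<noteq> {}"
  proof (rule INT_closed_conv_nonempty[OF \<open>L \<noteq> {}\<close>])
    fix p q
    assume "p \<in> I" "q \<in> I"
    then obtain m v n w where "p = (m, v)" "1 \<le> m" "v \<in> {1..m} \<rightarrow> L"
        "q = (n, w)" "1 \<le> n" "w \<in> {1..n} \<rightarrow> L"
      using \<open>H \<subseteq> L\<close> unfolding I_def by (cases p, cases q) (auto simp: Pi_iff subset_eq)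
    then show "(INF x\<in>L. f p x) \<le> (SUP x\<in>L. f q x)"
      unfolding f_def using INF_average_le_SUP_average[of k, OF sym] by simp
  qed
  moreover have "(\<Inter>i\<in>I. closed_conv {f i x | x. x \<in> L}) = R_inf k H L"
    by (auto simp: I_def f_def R_inf_def R_n_def)
  ultimately have R: "R_inf k H L \<noteq> {}"
    by simp
  moreover have "R_n k n H L \<noteq> {}" if "n \<ge> 1" for n
  proof -
    have "R_inf k H L \<subseteq> R_n k n H L"
      using that unfolding R_inf_def by (intro INT_lower) auto
    then show ?thesis
      using R by blast
  qed
  moreover have "A_set k H L \<noteq> {}"
    unfolding A_set_def using \<open>L \<noteq> {}\<close> assms(2,4)
    by (intro INT_closed_conv_nonempty INF_potential_le_SUP_potential)
  ultimately show ?thesis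
    by blast
qed

end
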